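(* Let $G$ be a group, let $\partial:M\to L$ be a $G$-equivariant crossed module with $A=\mathrm{Ker}(\partial)$, $Q=\mathrm{Coker}(\partial)$, and let $a\in H^0(G,Q)$. Then $o(a)=0$ in $H^2(G,A)$ if and only if there is an $(M\xrightarrow{\partial}L)$-bitorsor $P$ such that $\pi_*(P)=a$.
   Context: Groups are written multiplicatively. A crossed module $\partial:M\to L$ is a group homomorphism with an action $(\tau,m)\mapsto{}^\tau m$ of $L$ on $M$ by automorphisms such that $\partial({}^\tau m)=\tau\partial(m)\tau^{-1}$ and ${}^{\partial(n)}m=nmn^{-1}$. It is $G$-equivariant if $G$ acts on $M$ and $L$ by group automorphisms with $\partial({}^xm)={}^x\partial(m)$ and ${}^x({}^\tau m)={}^{({}^x\tau)}({}^xm)$. Then $A=\mathrm{Ker}(\partial)$ is a central, $G$-stable subgroup of $M$, $Q=L/\partial(M)$ inherits a $G$-action, $\pi:L\to Q$ is the quotient map, and $H^0(G,Q)$ is the set of $G$-fixed elements of $Q$. A right $M$-torsor is a nonempty set $P$ with a right action of $M$ and a left action of $G$ such that ${}^x(pm)={}^xp\,{}^xm$, and such that for all $p,q\in P$ there is a unique $m\in M$ with $q=pm$. An $(M\xrightarrow{\partial}L)$-bitorsor is a pair $(P,\alpha)$ with $P$ a right $M$-torsor and $\alpha:P\to L$ a function with $\alpha({}^xp)={}^x\alpha(p)$ and $\alpha(pm)=\alpha(p)\partial(m)$. Put $\xi(p)=\alpha(p)^{-1}$. The element $\pi_*(P):=\pi(\xi(p))\in Q$ does not depend on $p\in P$ and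 lies in $H^0(G,Q)$. Definition of $o(a)$: choose $x\in L$ with $\pi(x)=a$. Let $B^x$ be the group of pairs $(m,g)\in M\times G$ with $\partial(m)\,{}^gx=x$, with multiplication $(m,g)(n,h)=(m\,{}^gn,gh)$. There is a group extension $0\to A\xrightarrow{\kappa}B^x\xrightarrow{p}G\to 0$ with $\kappa(\alpha)=(\alpha,1)$, $p(m,g)=g$, inducing the given $G$-action on the abelian group $A$; $o(a)\in H^2(G,A)$ is the class of this extension. It does not depend on the choice of $x$. *)

theory Defs
  imports "HOL-Algebra.Algebra"
begin

section \<open>Equivariant crossed modules\<close>

text \<open>An action of a group \<open>G\<close> on a group \<open>M\<close> by automorphisms is a homomorphism from \<open>G\<close>
  to \<^term>\<open>AutoGroup M\<close>.\<close>

locale crossed_module =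
  fixes M :: "('m, 'r) monoid_scheme" and L :: "('l, 's) monoid_scheme"
    and d :: "'m \<Rightarrow> 'l" and lact :: "'l \<Rightarrow> 'm \<Rightarrow> 'm"
  assumes boundary_hom: "group_hom M L d"
    and lact_hom: "group_hom L (AutoGroup M) lact"
    and boundary_lact: "\<And>t m. \<lbrakk>t \<in> carrier L; m \<in> carrier M\<rbrakk> \<Longrightarrow>
          d (lact t m) = t \<otimes>\<^bsub>L\<^esub> d m \<otimes>\<^bsub>L\<^esub> inv\<^bsub>L\<^esub> t"
    and lact_boundary: "\<And>n m. \<lbrakk>n \<in> carrier M; m \<in> carrier M\<rbrakk> \<Longrightarrow>
          lact (d n) m = n \<otimes>\<^bsub>M\<^esub> m \<otimes>\<^bsub>M\<^esub> inv\<^bsub>M\<^esub> n"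

locale equivariant_crossed_module = crossed_module M L d lact
  for M :: "('m, 'r) monoid_scheme" and L :: "('l, 's) monoid_scheme"
    and d :: "'m \<Rightarrow> 'l" and lact :: "'l \<Rightarrow> 'm \<Rightarrow> 'm" +
  fixes G :: "('g, 't) monoid_scheme"
    and gM :: "'g \<Rightarrow> 'm \<Rightarrow> 'm" and gL :: "'g \<Rightarrow> 'l \<Rightarrow> 'l"
  assumes gM_hom: "group_hom G (AutoGroup M) gM"
    and gL_hom: "group_hom G (AutoGroup L) gL"
    and boundary_equivariant: "\<And>x m. \<lbrakk>x \<in> carrier G; m \<in> carrier M\<rbrakk> \<Longrightarrow>
          d (gM x m) = gL x (d m)"
    and lact_equivariant: "\<And>x t m. \<lbrakk>x \<in> carrier G; t \<in> carrier L; m \<in> carrier M\<rbrakk> \<Longrightarrow>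
          gM x (lact t m) = lact (gL x t) (gM x m)"

definition ker_group :: "('m, 'r) monoid_scheme \<Rightarrow> ('l, 's) monoid_scheme \<Rightarrow> ('m \<Rightarrow> 'l) \<Rightarrow>
    ('m, 'r) monoid_scheme" where
  "ker_group M L d = M\<lparr>carrier := kernel M L d\<rparr>"

definition ker_action :: "('m, 'r) monoid_scheme \<Rightarrow> ('l, 's) monoid_scheme \<Rightarrow> ('m \<Rightarrow> 'l) \<Rightarrow>
    ('g \<Rightarrow> 'm \<Rightarrow> 'm) \<Rightarrow> 'g \<Rightarrow> 'm \<Rightarrow> 'm" where
  "ker_action M L d gM x = restrict (gM x) (kernel M L d)"

definition coker_group :: "('m, 'r) monoid_scheme \<Rightarrow> ('l, 's) monoid_scheme \<Rightarrow> ('m \<Rightarrow> 'l) \<Rightarrow>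
    'l set monoid" where
  "coker_group M L d = L Mod (d ` carrier M)"

definition coker_proj :: "('m, 'r) monoid_scheme \<Rightarrow> ('l, 's) monoid_scheme \<Rightarrow> ('m \<Rightarrow> 'l) \<Rightarrow>
    'l \<Rightarrow> 'l set" where
  "coker_proj M L d t = (d ` carrier M) #>\<^bsub>L\<^esub> t"

text \<open>Elements of the cokernel are cosets, on which \<open>G\<close> acts elementwise: the image of the
  coset of \<open>t\<close> under \<open>gL x\<close> is the coset of \<open>gL x t\<close>.\<close>

definition coker_action :: "('m, 'r) monoid_scheme \<Rightarrow> ('l, 's) monoid_scheme \<Rightarrow> ('m \<Rightarrow> 'l) \<Rightarrow>
    ('g \<Rightarrow> 'l \<Rightarrow> 'l) \<Rightarrow> 'g \<Rightarrow> 'l set \<Rightarrow> 'l set" where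
  "coker_action M L d gL x = (\<lambda>c \<in> carrier (coker_group M L d). gL x ` c)"


section \<open>Group cohomology in degrees 0 and 2\<close>

definition H0 :: "('g, 't) monoid_scheme \<Rightarrow> ('a, 'u) monoid_scheme \<Rightarrow> ('g \<Rightarrow> 'a \<Rightarrow> 'a) \<Rightarrow> 'a set" where
  "H0 G Q act = {a \<in> carrier Q. \<forall>x \<in> carrier G. act x a = a}"

text \<open>Inhomogeneous, not necessarily normalised, cochains with values in a multiplicatively
  written abelian group \<open>A\<close>.\<close>

definition cocycles2 :: "('g, 't) monoid_scheme \<Rightarrow> ('a, 'u) monoid_scheme \<Rightarrow> ('g \<Rightarrow> 'a \<Rightarrow> 'a) \<Rightarrow>
    ('g \<times> 'g \<Rightarrow> 'a) monoid" where
  "cocycles2 G A act =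
    \<lparr>carrier = {f \<in> carrier G \<times> carrier G \<rightarrow>\<^sub>E carrier A.
        \<forall>x \<in> carrier G. \<forall>y \<in> carrier G. \<forall>z \<in> carrier G.
          act x (f (y, z)) \<otimes>\<^bsub>A\<^esub> f (x, y \<otimes>\<^bsub>G\<^esub> z) = f (x \<otimes>\<^bsub>G\<^esub> y, z) \<otimes>\<^bsub>A\<^esub> f (x, y)},
     monoid.mult = (\<lambda>f f'. \<lambda>u \<in> carrier G \<times> carrier G. f u \<otimes>\<^bsub>A\<^esub> f' u),
     one = (\<lambda>u \<in> carrier G \<times> carrier G. \<one>\<^bsub>A\<^esub>)\<rparr>"

definition coboundary1 :: "('g, 't) monoid_scheme \<Rightarrow> ('a, 'u) monoid_scheme \<Rightarrow> ('g \<Rightarrow> 'a \<Rightarrow> 'a) \<Rightarrow>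
    ('g \<Rightarrow> 'a) \<Rightarrow> 'g \<times> 'g \<Rightarrow> 'a" where
  "coboundary1 G A act c =
    (\<lambda>(x, y) \<in> carrier G \<times> carrier G.
       act x (c y) \<otimes>\<^bsub>A\<^esub> inv\<^bsub>A\<^esub> (c (x \<otimes>\<^bsub>G\<^esub> y)) \<otimes>\<^bsub>A\<^esub> c x)"

definition coboundaries2 :: "('g, 't) monoid_scheme \<Rightarrow> ('a, 'u) monoid_scheme \<Rightarrow> ('g \<Rightarrow> 'a \<Rightarrow> 'a) \<Rightarrow>
    ('g \<times> 'g \<Rightarrow> 'a) set" where
  "coboundaries2 G A act = coboundary1 G A act ` (carrier G \<rightarrow> carrier A)"

definition H2 :: "('g, 't) monoid_scheme \<Rightarrow> ('a, 'u) monoid_scheme \<Rightarrow> ('g \<Rightarrow> 'a \<Rightarrow> 'a) \<Rightarrow>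
    ('g \<times> 'g \<Rightarrow> 'a) set monoid" where
  "H2 G A act = cocycles2 G A act Mod coboundaries2 G A act"

text \<open>For a group extension \<open>A \<rightarrow> B \<rightarrow> G\<close> with maps \<open>k\<close>, \<open>p\<close> and a set-theoretic section \<open>s\<close> of
  \<open>p\<close>, the factor set \<open>f\<close> is determined by \<open>s x \<cdot> s y = k (f (x, y)) \<cdot> s (x y)\<close>. The class of
  the extension is the class of \<open>f\<close>, which does not depend on the choice of \<open>s\<close>.\<close>

definition factor_set :: "('g, 't) monoid_scheme \<Rightarrow> ('a, 'u) monoid_scheme \<Rightarrow>
    ('b, 'v) monoid_scheme \<Rightarrow> ('a \<Rightarrow> 'b) \<Rightarrow> ('g \<Rightarrow> 'b) \<Rightarrow> 'g \<times> 'g \<Rightarrow> 'a" where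
  "factor_set G A B k s =
    (\<lambda>(x, y) \<in> carrier G \<times> carrier G.
       inv_into (carrier A) k (s x \<otimes>\<^bsub>B\<^esub> s y \<otimes>\<^bsub>B\<^esub> inv\<^bsub>B\<^esub> (s (x \<otimes>\<^bsub>G\<^esub> y))))"

definition extension_class :: "('g, 't) monoid_scheme \<Rightarrow> ('a, 'u) monoid_scheme \<Rightarrow> ('g \<Rightarrow> 'a \<Rightarrow> 'a) \<Rightarrow>
    ('b, 'v) monoid_scheme \<Rightarrow> ('a \<Rightarrow> 'b) \<Rightarrow> ('b \<Rightarrow> 'g) \<Rightarrow> ('g \<times> 'g \<Rightarrow> 'a) set" where
  "extension_class G A act B k p =
    (let s = (SOME s. s \<in> carrier G \<rightarrow> carrier B \<and> (\<forall>x \<in> carrier G. p (s x) = x))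
     in coboundaries2 G A act #>\<^bsub>cocycles2 G A act\<^esub> factor_set G A B k s)"


section \<open>The obstruction class\<close>

definition obstruction_group :: "('m, 'r) monoid_scheme \<Rightarrow> ('l, 's) monoid_scheme \<Rightarrow> ('m \<Rightarrow> 'l) \<Rightarrow>
    ('g, 't) monoid_scheme \<Rightarrow> ('g \<Rightarrow> 'm \<Rightarrow> 'm) \<Rightarrow> ('g \<Rightarrow> 'l \<Rightarrow> 'l) \<Rightarrow> 'l \<Rightarrow> ('m \<times> 'g) monoid" where
  "obstruction_group M L d G gM gL x =
    \<lparr>carrier = {(m, g). m \<in> carrier M \<and> g \<in> carrier G \<and> d m \<otimes>\<^bsub>L\<^esub> gL g x = x},
     monoid.mult = (\<lambda>(m, g) (n, h). (m \<otimes>\<^bsub>M\<^esub> gM g n, g \<otimes>\<^bsub>G\<^esub> h)),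
     one = (\<one>\<^bsub>M\<^esub>, \<one>\<^bsub>G\<^esub>)\<rparr>"

definition obstruction :: "('m, 'r) monoid_scheme \<Rightarrow> ('l, 's) monoid_scheme \<Rightarrow> ('m \<Rightarrow> 'l) \<Rightarrow>
    ('g, 't) monoid_scheme \<Rightarrow> ('g \<Rightarrow> 'm \<Rightarrow> 'm) \<Rightarrow> ('g \<Rightarrow> 'l \<Rightarrow> 'l) \<Rightarrow> 'l set \<Rightarrow>
    ('g \<times> 'g \<Rightarrow> 'm) set" where
  "obstruction M L d G gM gL a =
    (let x = (SOME x. x \<in> carrier L \<and> coker_proj M L d x = a)
     in extension_class G (ker_group M L d) (ker_action M L d gM)
          (obstruction_group M L d G gM gL x) (\<lambda>\<alpha>. (\<alpha>, \<one>\<^bsub>G\<^esub>)) snd)"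


section \<open>Bitorsors\<close>

locale right_torsor =
  fixes M :: "('m, 'r) monoid_scheme" and G :: "('g, 't) monoid_scheme"
    and gM :: "'g \<Rightarrow> 'm \<Rightarrow> 'm"
    and P :: "'p set" and ract :: "'p \<Rightarrow> 'm \<Rightarrow> 'p" and gP :: "'g \<Rightarrow> 'p \<Rightarrow> 'p"
  assumes nonempty: "P \<noteq> {}"
    and ract_closed: "\<And>p m. \<lbrakk>p \<in> P; m \<in> carrier M\<rbrakk> \<Longrightarrow> ract p m \<in> P"
    and ract_one: "\<And>p. p \<in> P \<Longrightarrow> ract p \<one>\<^bsub>M\<^esub> = p"
    and ract_mult: "\<And>p m n. \<lbrakk>p \<in> P; m \<in> carrier M; n \<in> carrier M\<rbrakk> \<Longrightarrow>
          ract p (m \<otimes>\<^bsub>M\<^esub> n) = ract (ract p m) n"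
    and left_action: "group_action G P gP"
    and compatible: "\<And>x p m. \<lbrakk>x \<in> carrier G; p \<in> P; m \<in> carrier M\<rbrakk> \<Longrightarrow>
          gP x (ract p m) = ract (gP x p) (gM x m)"
    and simply_transitive: "\<And>p q. \<lbrakk>p \<in> P; q \<in> P\<rbrakk> \<Longrightarrow> \<exists>!m. m \<in> carrier M \<and> q = ract p m"

locale bitorsor = right_torsor M G gM P ract gP
  for M :: "('m, 'r) monoid_scheme" and L :: "('l, 's) monoid_scheme" and d :: "'m \<Rightarrow> 'l"
    and G :: "('g, 't) monoid_scheme"
    and gM :: "'g \<Rightarrow> 'm \<Rightarrow> 'm" and gL :: "'g \<Rightarrow> 'l \<Rightarrow> 'l"
    and P :: "'p set" and ract :: "'p \<Rightarrow> 'm \<Rightarrow> 'p" and gP :: "'g \<Rightarrow> 'p \<Rightarrow> 'p" +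
  fixes \<alpha> :: "'p \<Rightarrow> 'l"
  assumes alpha_closed: "\<alpha> \<in> P \<rightarrow> carrier L"
    and alpha_equivariant: "\<And>x p. \<lbrakk>x \<in> carrier G; p \<in> P\<rbrakk> \<Longrightarrow> \<alpha> (gP x p) = gL x (\<alpha> p)"
    and alpha_ract: "\<And>p m. \<lbrakk>p \<in> P; m \<in> carrier M\<rbrakk> \<Longrightarrow> \<alpha> (ract p m) = \<alpha> p \<otimes>\<^bsub>L\<^esub> d m"

definition bitorsor_xi :: "('l, 's) monoid_scheme \<Rightarrow> ('p \<Rightarrow> 'l) \<Rightarrow> 'p \<Rightarrow> 'l" where
  "bitorsor_xi L \<alpha> p = inv\<^bsub>L\<^esub> (\<alpha> p)"

text \<open>For a bitorsor the image below is a singleton.\<close>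

definition pi_star :: "('m, 'r) monoid_scheme \<Rightarrow> ('l, 's) monoid_scheme \<Rightarrow> ('m \<Rightarrow> 'l) \<Rightarrow>
    'p set \<Rightarrow> ('p \<Rightarrow> 'l) \<Rightarrow> 'l set" where
  "pi_star M L d P \<alpha> = the_elem ((\<lambda>p. coker_proj M L d (bitorsor_xi L \<alpha> p)) ` P)"

end

theory Submission
  imports Defs
begin

text \<open>Let \<open>\<pi>(x) = a\<close>. A section of \<open>B\<^sup>x \<rightarrow> G\<close> has the form \<open>g \<mapsto> (m g, g)\<close>, and its factor set is
  \<open>m g \<cdot> \<^sup>gm h \<cdot> (m (g h))\<^sup>-\<^sup>1\<close>. Since \<open>A\<close> is central, writing it as the coboundary of \<open>c\<close> amounts to
  saying that \<open>g \<mapsto> ((c g)\<^sup>-\<^sup>1 \<cdot> m g, g)\<close> is a homomorphism. So \<open>o(a)\<close> vanishes iff there is a crossed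
  homomorphism \<open>n : G \<rightarrow> M\<close> with \<open>\<partial>(n g) \<cdot> \<^sup>gx = x\<close>. Such an \<open>n\<close> twists the trivial torsor \<open>M\<close> into a
  bitorsor via \<open>g \<cdot> p = n g \<cdot> \<^sup>gp\<close> and \<open>\<alpha> p = x\<^sup>-\<^sup>1 \<cdot> \<partial> p\<close>. Conversely, a bitorsor over \<open>a\<close> contains a
  point \<open>q\<close> with \<open>\<alpha> q = x\<^sup>-\<^sup>1\<close>, and \<open>n\<close> is read off from \<open>\<^sup>gq = q \<cdot> n g\<close>.\<close>

section \<open>Actions by automorphisms: a common frame for L on M, G on M and G on L\<close>

locale automorphism_action = G: group G + M: group M
  for G :: "('g, 't) monoid_scheme" and M :: "('m, 'r) monoid_scheme" and act :: "'g \<Rightarrow> 'm \<Rightarrow> 'm" +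
  assumes act_hom: "group_hom G (AutoGroup M) act"
begin

lemma act_auto: "x \<in> carrier G \<Longrightarrow> act x \<in> hom M M \<inter> Bij (carrier M)"
  using group_hom.hom_closed[OF act_hom] by (simp add: AutoGroup_def auto_def)

lemma act_in_hom: "x \<in> carrier G \<Longrightarrow> act x \<in> hom M M"
  using act_auto by blast

lemma act_closed [simp]: "\<lbrakk>x \<in> carrier G; m \<in> carrier M\<rbrakk> \<Longrightarrow> act x m \<in> carrier M"
  using act_in_hom by (auto simp: hom_def)

lemma act_mult: "\<lbrakk>x \<in> carrier G; m \<in> carrier M; n \<in> carrier M\<rbrakk> \<Longrightarrow>
    act x (m \<otimes>\<^bsub>M\<^esub> n) = act x m \<otimes>\<^bsub>M\<^esub> act x n"
  using act_in_hom by (simp add: hom_mult)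

lemma act_group_hom: "x \<in> carrier G \<Longrightarrow> group_hom M M (act x)"
  by (simp add: M.group_axioms act_in_hom group_hom_axioms_def group_hom_def)

lemma act_one: "x \<in> carrier G \<Longrightarrow> act x \<one>\<^bsub>M\<^esub> = \<one>\<^bsub>M\<^esub>"
  by (rule group_hom.hom_one[OF act_group_hom])

lemma act_inv: "\<lbrakk>x \<in> carrier G; m \<in> carrier M\<rbrakk> \<Longrightarrow> act x (inv\<^bsub>M\<^esub> m) = inv\<^bsub>M\<^esub> act x m"
  by (rule group_hom.hom_inv[OF act_group_hom])

lemma act_comp: "\<lbrakk>x \<in> carrier G; y \<in> carrier G; m \<in> carrier M\<rbrakk> \<Longrightarrow>
    act (x \<otimes>\<^bsub>G\<^esub> y) m = act x (act y m)"
  using group_hom.hom_mult[OF act_hom, of x y] act_auto[of x] act_auto[of y]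
  by (simp add: AutoGroup_def BijGroup_def compose_def)

lemma one_act: "m \<in> carrier M \<Longrightarrow> act \<one>\<^bsub>G\<^esub> m = m"
  using group_hom.hom_one[OF act_hom] by (simp add: AutoGroup_def BijGroup_def)

end

section \<open>Cosets of the 2-coboundaries\<close>

lemma coboundary1_mult:
  assumes "group G" "comm_group A" and act: "\<And>x. x \<in> carrier G \<Longrightarrow> act x \<in> hom A A"
    and c: "c \<in> carrier G \<rightarrow> carrier A" "c' \<in> carrier G \<rightarrow> carrier A"
  shows "coboundary1 G A act c \<otimes>\<^bsub>cocycles2 G A act\<^esub> coboundary1 G A act c' =
    coboundary1 G A act (\<lambda>x. c x \<otimes>\<^bsub>A\<^esub> c' x)"
proof -
  interpret G: group G by fact
  interpret A: comm_group A by fact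
  have "(act x (c y) \<otimes>\<^bsub>A\<^esub> inv\<^bsub>A\<^esub> c (x \<otimes>\<^bsub>G\<^esub> y) \<otimes>\<^bsub>A\<^esub> c x) \<otimes>\<^bsub>A\<^esub>
      (act x (c' y) \<otimes>\<^bsub>A\<^esub> inv\<^bsub>A\<^esub> c' (x \<otimes>\<^bsub>G\<^esub> y) \<otimes>\<^bsub>A\<^esub> c' x) =
      act x (c y \<otimes>\<^bsub>A\<^esub> c' y) \<otimes>\<^bsub>A\<^esub> inv\<^bsub>A\<^esub> (c (x \<otimes>\<^bsub>G\<^esub> y) \<otimes>\<^bsub>A\<^esub> c' (x \<otimes>\<^bsub>G\<^esub> y)) \<otimes>\<^bsub>A\<^esub> (c x \<otimes>\<^bsub>A\<^esub> c' x)"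
    if "x \<in> carrier G" "y \<in> carrier G" for x y
  proof -
    have mem: "c x \<in> carrier A" "c y \<in> carrier A" "c' x \<in> carrier A" "c' y \<in> carrier A"
      "c (x \<otimes>\<^bsub>G\<^esub> y) \<in> carrier A" "c' (x \<otimes>\<^bsub>G\<^esub> y) \<in> carrier A"
      using that c by auto
    then have "act x (c y) \<in> carrier A" "act x (c' y) \<in> carrier A"
      using act[OF that(1)] by (auto simp: hom_def)
    then show ?thesis
      using mem hom_mult[OF act[OF that(1)] mem(2,4)] by (simp add: A.m_ac A.inv_mult)
  qed
  then show ?thesis
    by (auto simp: coboundary1_def cocycles2_def restrict_def)
qed

lemma coboundary1_cong:
  assumes "group G" "\<And>x. x \<in> carrier G \<Longrightarrow> c x = c' x"
  shows "coboundary1 G A act c = coboundary1 G A act c'"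
proof -
  interpret G: group G by fact
  show ?thesis
    by (auto simp: coboundary1_def restrict_def assms(2))
qed

text \<open>The identity of H^2 is the set of coboundaries itself, so this is the criterion for a
  class to vanish. It comes down to the fact that c \<mapsto> dc is multiplicative, A being
  commutative. Only the pointwise product enters, so f may be any extensional A-valued
  function.\<close>

lemma coset_coboundaries2_eq_iff:
  assumes "group G" "comm_group A" and act: "\<And>x. x \<in> carrier G \<Longrightarrow> act x \<in> hom A A"
    and f: "f \<in> carrier G \<times> carrier G \<rightarrow>\<^sub>E carrier A"
  shows "coboundaries2 G A act #>\<^bsub>cocycles2 G A act\<^esub> f = coboundaries2 G A act \<longleftrightarrow>
    f \<in> coboundaries2 G A act"
proof
  interpret G: group G by fact
  interpret A: comm_group A by fact
  have act_one: "act x \<one>\<^bsub>A\<^esub> = \<one>\<^bsub>A\<^esub>" if "x \<in> carrier G" for x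
    using hom_one[OF act[OF that] A.group_axioms A.group_axioms] .
  {
    assume *: "coboundaries2 G A act #>\<^bsub>cocycles2 G A act\<^esub> f = coboundaries2 G A act"
    \<comment> \<open>The coboundary of the constant cochain 1 is a neutral factor, which places f
      in its own coset. Outside the domain both sides are \<open>undefined\<close>, by
      extensionality of f.\<close>
    have "f = coboundary1 G A act (\<lambda>_. \<one>\<^bsub>A\<^esub>) \<otimes>\<^bsub>cocycles2 G A act\<^esub> f"
    proof
      fix u
      have "f u \<in> carrier A" if "u \<in> carrier G \<times> carrier G"
        using f that by blast
      moreover have "f u = undefined" if "u \<notin> carrier G \<times> carrier G"
        using f that by (meson PiE_arb)
      ultimately show "f u = (coboundary1 G A act (\<lambda>_. \<one>\<^bsub>A\<^esub>) \<otimes>\<^bsub>cocycles2 G A act\<^esub> f) u"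
        by (auto simp: coboundary1_def cocycles2_def act_one)
    qed
    moreover have "coboundary1 G A act (\<lambda>_. \<one>\<^bsub>A\<^esub>) \<in> coboundaries2 G A act"
      unfolding coboundaries2_def by blast
    ultimately have "f \<in> coboundaries2 G A act #>\<^bsub>cocycles2 G A act\<^esub> f"
      unfolding r_coset_def by blast
    then show "f \<in> coboundaries2 G A act"
      using * by simp
  next
    assume "f \<in> coboundaries2 G A act"
    then obtain c where c: "c \<in> carrier G \<rightarrow> carrier A" "f = coboundary1 G A act c"
      unfolding coboundaries2_def by blast
    note mult = coboundary1_mult[OF assms(1,2) act]
    show "coboundaries2 G A act #>\<^bsub>cocycles2 G A act\<^esub> f = coboundaries2 G A act"
    proof
      show "coboundaries2 G A act #>\<^bsub>cocycles2 G A act\<^esub> f \<subseteq> coboundaries2 G A act"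
      proof
        fix h assume "h \<in> coboundaries2 G A act #>\<^bsub>cocycles2 G A act\<^esub> f"
        then obtain c' where c': "c' \<in> carrier G \<rightarrow> carrier A"
          "h = coboundary1 G A act c' \<otimes>\<^bsub>cocycles2 G A act\<^esub> f"
          unfolding r_coset_def coboundaries2_def by blast
        have "(\<lambda>x. c' x \<otimes>\<^bsub>A\<^esub> c x) \<in> carrier G \<rightarrow> carrier A"
          using c c' by auto
        moreover have "h = coboundary1 G A act (\<lambda>x. c' x \<otimes>\<^bsub>A\<^esub> c x)"
          using c c' mult by simp
        ultimately show "h \<in> coboundaries2 G A act"
          unfolding coboundaries2_def by blast
      qed
      show "coboundaries2 G A act \<subseteq> coboundaries2 G A act #>\<^bsub>cocycles2 G A act\<^esub> f"
      proof
        fix h assume "h \<in> coboundaries2 G A act"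
        then obtain c' where c': "c' \<in> carrier G \<rightarrow> carrier A" "h = coboundary1 G A act c'"
          unfolding coboundaries2_def by blast
        \<comment> \<open>The cochain \<open>?e\<close> is the quotient of c' by c; multiplicativity
          then gives dc' = de \<otimes> dc with dc = f.\<close>
        let ?e = "\<lambda>x. c' x \<otimes>\<^bsub>A\<^esub> inv\<^bsub>A\<^esub> c x"
        have e: "?e \<in> carrier G \<rightarrow> carrier A"
          using c c' by auto
        have "h = coboundary1 G A act (\<lambda>x. ?e x \<otimes>\<^bsub>A\<^esub> c x)"
          unfolding c'(2)
        proof (rule coboundary1_cong[OF assms(1)])
          fix x assume "x \<in> carrier G"
          then have "c x \<in> carrier A" "c' x \<in> carrier A"
            using c c' by auto
          then show "c' x = ?e x \<otimes>\<^bsub>A\<^esub> c x"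
            by (simp add: A.m_assoc)
        qed
        also have "\<dots> = coboundary1 G A act ?e \<otimes>\<^bsub>cocycles2 G A act\<^esub> f"
          using mult[OF _ e c(1)] c(2) by simp
        finally show "h \<in> coboundaries2 G A act #>\<^bsub>cocycles2 G A act\<^esub> f"
          using e unfolding r_coset_def coboundaries2_def by blast
      qed
    qed
  }
qed

section \<open>Crossed modules: the central kernel and the cosets forming the cokernel\<close>

context crossed_module
begin

sublocale M: group M
  using boundary_hom by (simp add: group_hom_def)

sublocale L: group L
  using boundary_hom by (simp add: group_hom_def)

sublocale boundary: group_hom M L d
  by (rule boundary_hom)

sublocale lact: automorphism_action L M lact
  by (intro automorphism_action.intro automorphism_action_axioms.intro L.group_axioms M.group_axioms lact_hom)

abbreviation A where "A \<equiv> ker_group M L d"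

lemma carrier_A: "u \<in> carrier A \<longleftrightarrow> u \<in> carrier M \<and> d u = \<one>\<^bsub>L\<^esub>"
  by (simp add: ker_group_def kernel_def)

lemma mult_A: "(\<otimes>\<^bsub>A\<^esub>) = (\<otimes>\<^bsub>M\<^esub>)"
  by (simp add: ker_group_def)

lemma inv_A: "u \<in> carrier A \<Longrightarrow> inv\<^bsub>A\<^esub> u = inv\<^bsub>M\<^esub> u"
  using M.m_inv_consistent[OF boundary.subgroup_kernel] by (simp add: ker_group_def)

text \<open>Conjugation by u is the action of \<open>d u = 1\<close>, which is trivial.\<close>

lemma A_central:
  assumes u: "u \<in> carrier A" and m: "m \<in> carrier M"
  shows "u \<otimes>\<^bsub>M\<^esub> m = m \<otimes>\<^bsub>M\<^esub> u"
proof -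
  have "u \<otimes>\<^bsub>M\<^esub> m \<otimes>\<^bsub>M\<^esub> inv\<^bsub>M\<^esub> u = m"
    using lact_boundary[of u m] u m by (simp add: carrier_A lact.one_act)
  then show ?thesis
    using u m M.inv_solve_right'[of m "u \<otimes>\<^bsub>M\<^esub> m" u] by (simp add: carrier_A)
qed

lemma A_comm_group: "comm_group A"
proof (rule group.group_comm_groupI)
  show "group A"
    unfolding ker_group_def by (rule M.subgroup_imp_group[OF boundary.subgroup_kernel])
qed (simp add: mult_A A_central carrier_A[THEN iffD1, THEN conjunct1])

text \<open>The projection takes right cosets, so representatives differ by a factor
  \<open>d m\<close> on the left. This is the same shape as the condition defining the elements of
  \<open>B x\<close>.\<close>

lemma coker_proj_eq_iff:
  assumes "x \<in> carrier L" "y \<in> carrier L"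
  shows "coker_proj M L d x = coker_proj M L d y \<longleftrightarrow> (\<exists>m \<in> carrier M. x = d m \<otimes>\<^bsub>L\<^esub> y)"
proof
  have sub: "subgroup (d ` carrier M) L"
    by (rule boundary.img_is_subgroup)
  have self: "x \<in> d ` carrier M #>\<^bsub>L\<^esub> x"
    by (rule L.rcos_self[OF assms(1) sub])
  show "\<exists>m \<in> carrier M. x = d m \<otimes>\<^bsub>L\<^esub> y" if "coker_proj M L d x = coker_proj M L d y"
    using self that unfolding coker_proj_def r_coset_def by blast
  show "coker_proj M L d x = coker_proj M L d y" if "\<exists>m \<in> carrier M. x = d m \<otimes>\<^bsub>L\<^esub> y"
  proof -
    have "x \<in> d ` carrier M #>\<^bsub>L\<^esub> y"
      using that unfolding r_coset_def by blast
    then show ?thesis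
      unfolding coker_proj_def using L.repr_independence[OF _ assms(2) sub] by simp
  qed
qed

end

section \<open>The extension \<open>B x\<close>, its factor sets and its splittings\<close>

context equivariant_crossed_module
begin

sublocale G: group G
  using gM_hom by (simp add: group_hom_def)

sublocale gM: automorphism_action G M gM
  by (intro automorphism_action.intro automorphism_action_axioms.intro G.group_axioms M.group_axioms gM_hom)

sublocale gL: automorphism_action G L gL
  by (intro automorphism_action.intro automorphism_action_axioms.intro G.group_axioms L.group_axioms gL_hom)

lemma ker_action_eq: "u \<in> carrier A \<Longrightarrow> ker_action M L d gM x u = gM x u"
  by (simp add: ker_action_def ker_group_def)

lemma gM_A_closed: "\<lbrakk>x \<in> carrier G; u \<in> carrier A\<rbrakk> \<Longrightarrow> gM x u \<in> carrier A"
  by (simp add: carrier_A boundary_equivariant gL.act_one)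

lemma ker_action_hom:
  assumes "x \<in> carrier G"
  shows "ker_action M L d gM x \<in> hom A A"
proof (rule homI)
  interpret A: comm_group A by (rule A_comm_group)
  fix u v assume uv: "u \<in> carrier A" "v \<in> carrier A"
  then show "ker_action M L d gM x u \<in> carrier A"
    by (simp add: ker_action_eq gM_A_closed assms)
  have "u \<otimes>\<^bsub>M\<^esub> v \<in> carrier A"
    using A.m_closed[OF uv] by (simp add: mult_A)
  then show "ker_action M L d gM x (u \<otimes>\<^bsub>A\<^esub> v) = ker_action M L d gM x u \<otimes>\<^bsub>A\<^esub> ker_action M L d gM x v"
    using uv assms by (simp add: ker_action_eq mult_A gM.act_mult carrier_A)
qed

text \<open>These are the crossed homomorphisms n for which \<open>g \<mapsto> (n g, g)\<close> is a
  homomorphic section of the extension \<open>B x\<close> of G. The second clause says that the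
  pairs lie in \<open>B x\<close>, the third that the section is multiplicative.\<close>

definition splitting :: "'l \<Rightarrow> ('g \<Rightarrow> 'm) \<Rightarrow> bool" where
  "splitting x n \<longleftrightarrow> n \<in> carrier G \<rightarrow> carrier M \<and>
     (\<forall>g \<in> carrier G. d (n g) \<otimes>\<^bsub>L\<^esub> gL g x = x) \<and>
     (\<forall>g \<in> carrier G. \<forall>h \<in> carrier G. n (g \<otimes>\<^bsub>G\<^esub> h) = n g \<otimes>\<^bsub>M\<^esub> gM g (n h))"

abbreviation B where "B \<equiv> obstruction_group M L d G gM gL"

lemma carrier_B: "(m, g) \<in> carrier (B x) \<longleftrightarrow>
    m \<in> carrier M \<and> g \<in> carrier G \<and> d m \<otimes>\<^bsub>L\<^esub> gL g x = x"
  by (simp add: obstruction_group_def)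

lemma mult_B: "(m, g) \<otimes>\<^bsub>B x\<^esub> (n, h) = (m \<otimes>\<^bsub>M\<^esub> gM g n, g \<otimes>\<^bsub>G\<^esub> h)"
  by (simp add: obstruction_group_def)

lemma one_B: "\<one>\<^bsub>B x\<^esub> = (\<one>\<^bsub>M\<^esub>, \<one>\<^bsub>G\<^esub>)"
  by (simp add: obstruction_group_def)

text \<open>The right-hand side is nested so that the membership conditions of \<open>(n, h)\<close>
  and then \<open>(m, g)\<close> collapse it to x. This gives closure of \<open>B x\<close>, and
  later the boundary of a product of section values.\<close>

lemma d_mult_gM:
  assumes x: "x \<in> carrier L" and mg: "m \<in> carrier M" "g \<in> carrier G" and nh: "n \<in> carrier M" "h \<in> carrier G"
  shows "d (m \<otimes>\<^bsub>M\<^esub> gM g n) \<otimes>\<^bsub>L\<^esub> gL (g \<otimes>\<^bsub>G\<^esub> h) x = d m \<otimes>\<^bsub>L\<^esub> gL g (d n \<otimes>\<^bsub>L\<^esub> gL h x)"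
  using assms by (simp add: boundary_equivariant gL.act_mult gL.act_comp L.m_assoc)

lemma B_group:
  assumes x: "x \<in> carrier L"
  shows "group (B x)"
proof (rule groupI)
  fix u v assume "u \<in> carrier (B x)" "v \<in> carrier (B x)"
  then show "u \<otimes>\<^bsub>B x\<^esub> v \<in> carrier (B x)"
    using x by (cases u; cases v) (simp add: carrier_B mult_B d_mult_gM del: boundary.hom_mult)
next
  show "\<one>\<^bsub>B x\<^esub> \<in> carrier (B x)"
    using x by (simp add: one_B carrier_B gL.one_act)
next
  fix u v w assume "u \<in> carrier (B x)" "v \<in> carrier (B x)" "w \<in> carrier (B x)"
  then show "u \<otimes>\<^bsub>B x\<^esub> v \<otimes>\<^bsub>B x\<^esub> w = u \<otimes>\<^bsub>B x\<^esub> (v \<otimes>\<^bsub>B x\<^esub> w)"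
    by (cases u; cases v; cases w)
      (simp add: carrier_B mult_B gM.act_mult gM.act_comp M.m_assoc G.m_assoc)
next
  fix u assume "u \<in> carrier (B x)"
  then show "\<one>\<^bsub>B x\<^esub> \<otimes>\<^bsub>B x\<^esub> u = u"
    by (cases u) (simp add: carrier_B mult_B one_B gM.one_act)
next
  fix u assume u: "u \<in> carrier (B x)"
  obtain m g where mg: "u = (m, g)" by (cases u)
  with u have mem: "m \<in> carrier M" "g \<in> carrier G" and eq: "d m \<otimes>\<^bsub>L\<^esub> gL g x = x"
    by (auto simp: carrier_B)
  let ?v = "(gM (inv\<^bsub>G\<^esub> g) (inv\<^bsub>M\<^esub> m), inv\<^bsub>G\<^esub> g)"
  \<comment> \<open>The membership condition of u, solved for \<open>gL g x\<close>. Applying the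
    inverse of g turns it into the membership condition of \<open>?v\<close>.\<close>
  have "gL g x = inv\<^bsub>L\<^esub> d m \<otimes>\<^bsub>L\<^esub> x"
    using eq mem x by (metis L.inv_solve_left boundary.hom_closed gL.act_closed)
  then have "gL (inv\<^bsub>G\<^esub> g) (inv\<^bsub>L\<^esub> d m \<otimes>\<^bsub>L\<^esub> x) = x"
    using mem x by (metis G.inv_closed G.l_inv gL.act_comp gL.one_act)
  then have "?v \<in> carrier (B x)"
    using mem x by (simp add: carrier_B boundary_equivariant gL.act_mult)
  moreover have "?v \<otimes>\<^bsub>B x\<^esub> u = \<one>\<^bsub>B x\<^esub>"
    using mem by (simp add: mg mult_B one_B gM.act_mult[symmetric] gM.act_one)
  ultimately show "\<exists>v \<in> carrier (B x). v \<otimes>\<^bsub>B x\<^esub> u = \<one>\<^bsub>B x\<^esub>" by blast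
qed

text \<open>Both \<open>s g \<otimes> s h\<close> and \<open>s (g \<otimes> h)\<close> lie in
  \<open>B x\<close> over the same element of G. Their first components therefore have equal
  boundaries, and the quotient u of these components falls into the kernel A.\<close>

lemma factor_set_B:
  assumes x: "x \<in> carrier L"
    and s: "s \<in> carrier G \<rightarrow> carrier (B x)" "\<And>g. g \<in> carrier G \<Longrightarrow> s g = (m g, g)"
    and gh: "g \<in> carrier G" "h \<in> carrier G"
  defines "u \<equiv> m g \<otimes>\<^bsub>M\<^esub> gM g (m h) \<otimes>\<^bsub>M\<^esub> inv\<^bsub>M\<^esub> m (g \<otimes>\<^bsub>G\<^esub> h)"
  shows "u \<in> carrier A"
    and "factor_set G A (B x) (\<lambda>u. (u, \<one>\<^bsub>G\<^esub>)) s (g, h) = u"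
proof -
  interpret B: group "B x" by (rule B_group[OF x])
  have sm: "m k \<in> carrier M" "d (m k) \<otimes>\<^bsub>L\<^esub> gL k x = x" if "k \<in> carrier G" for k
    using s that by (auto simp: Pi_iff carrier_B)
  have gh': "g \<otimes>\<^bsub>G\<^esub> h \<in> carrier G" using gh by simp
  have "d (m g \<otimes>\<^bsub>M\<^esub> gM g (m h)) \<otimes>\<^bsub>L\<^esub> gL (g \<otimes>\<^bsub>G\<^esub> h) x =
      d (m (g \<otimes>\<^bsub>G\<^esub> h)) \<otimes>\<^bsub>L\<^esub> gL (g \<otimes>\<^bsub>G\<^esub> h) x"
    using sm gh gh' x by (simp only: d_mult_gM)
  then have "d (m g \<otimes>\<^bsub>M\<^esub> gM g (m h)) = d (m (g \<otimes>\<^bsub>G\<^esub> h))"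
    using sm gh gh' x by (metis L.r_cancel M.m_closed boundary.hom_closed gL.act_closed gM.act_closed)
  then have "d u = d (m (g \<otimes>\<^bsub>G\<^esub> h)) \<otimes>\<^bsub>L\<^esub> inv\<^bsub>L\<^esub> d (m (g \<otimes>\<^bsub>G\<^esub> h))"
    unfolding u_def using sm gh gh' by (metis M.inv_closed M.m_closed boundary.hom_inv boundary.hom_mult gM.act_closed)
  then show u: "u \<in> carrier A"
    using sm gh gh' by (simp add: carrier_A) (simp add: u_def)
  then have uB: "(u, \<one>\<^bsub>G\<^esub>) \<in> carrier (B x)"
    using x by (simp add: carrier_A carrier_B gL.one_act)
  have "s g \<otimes>\<^bsub>B x\<^esub> s h = (u, \<one>\<^bsub>G\<^esub>) \<otimes>\<^bsub>B x\<^esub> s (g \<otimes>\<^bsub>G\<^esub> h)"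
    using sm gh gh' by (simp add: s(2) mult_B gM.one_act u_def M.m_assoc)
  moreover have "s (g \<otimes>\<^bsub>G\<^esub> h) \<in> carrier (B x)"
    using s(1) gh' by blast
  ultimately have "s g \<otimes>\<^bsub>B x\<^esub> s h \<otimes>\<^bsub>B x\<^esub> inv\<^bsub>B x\<^esub> s (g \<otimes>\<^bsub>G\<^esub> h) = (u, \<one>\<^bsub>G\<^esub>)"
    using uB by (simp add: B.m_assoc)
  moreover have "inv_into (carrier A) (\<lambda>u. (u, \<one>\<^bsub>G\<^esub>)) (u, \<one>\<^bsub>G\<^esub>) = u"
    using inv_into_f_f[of "\<lambda>u. (u, \<one>\<^bsub>G\<^esub>)" "carrier A" u] u by (simp add: inj_on_def)
  ultimately show "factor_set G A (B x) (\<lambda>u. (u, \<one>\<^bsub>G\<^esub>)) s (g, h) = u"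
    using gh by (simp add: factor_set_def)
qed

text \<open>The unprimed, primed and doubly primed letters stand for the values at g, h and gh. The
  left side then says that the factor set of m is the coboundary of c, the right side that
  \<open>inv (c g) \<otimes> m g\<close> is a crossed homomorphism. Centrality of A converts one
  into the other.\<close>

lemma crossed_hom_iff_coboundary:
  assumes c: "c \<in> carrier A" "c' \<in> carrier A" "c'' \<in> carrier A"
    and m: "m \<in> carrier M" "m' \<in> carrier M" "m'' \<in> carrier M" and g: "g \<in> carrier G"
  shows "m \<otimes>\<^bsub>M\<^esub> gM g m' \<otimes>\<^bsub>M\<^esub> inv\<^bsub>M\<^esub> m'' = gM g c' \<otimes>\<^bsub>M\<^esub> inv\<^bsub>M\<^esub> c'' \<otimes>\<^bsub>M\<^esub> c \<longleftrightarrow>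
    inv\<^bsub>M\<^esub> c'' \<otimes>\<^bsub>M\<^esub> m'' = inv\<^bsub>M\<^esub> c \<otimes>\<^bsub>M\<^esub> m \<otimes>\<^bsub>M\<^esub> gM g (inv\<^bsub>M\<^esub> c' \<otimes>\<^bsub>M\<^esub> m')"
proof -
  interpret A: comm_group A by (rule A_comm_group)
  have cM [simp]: "c \<in> carrier M" "c' \<in> carrier M" "c'' \<in> carrier M"
    using c by (auto simp: carrier_A)
  define e where "e = gM g c'"
  have e: "e \<in> carrier A" "e \<in> carrier M"
    using gM_A_closed[OF g c(2)] by (auto simp: e_def carrier_A)
  define w where "w = gM g m'"
  have w: "w \<in> carrier M" using g m by (simp add: w_def)
  have act: "gM g (inv\<^bsub>M\<^esub> c' \<otimes>\<^bsub>M\<^esub> m') = inv\<^bsub>M\<^esub> e \<otimes>\<^bsub>M\<^esub> w"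
    using g m by (simp add: e_def w_def gM.act_mult gM.act_inv)
  have inv_e: "inv\<^bsub>M\<^esub> e \<in> carrier A"
    using A.inv_closed[OF e(1)] inv_A[OF e(1)] by simp
  \<comment> \<open>The inverse of e is central, so it moves to the left of m and joins the inverse
    of c.\<close>
  have "inv\<^bsub>M\<^esub> c \<otimes>\<^bsub>M\<^esub> m \<otimes>\<^bsub>M\<^esub> (inv\<^bsub>M\<^esub> e \<otimes>\<^bsub>M\<^esub> w) = inv\<^bsub>M\<^esub> c \<otimes>\<^bsub>M\<^esub> inv\<^bsub>M\<^esub> e \<otimes>\<^bsub>M\<^esub> (m \<otimes>\<^bsub>M\<^esub> w)"
    using A_central[OF inv_e m(1)] m(1) w e(2)
    by (smt (verit) M.inv_closed M.m_assoc M.m_closed cM(1))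
  also have "\<dots> = inv\<^bsub>M\<^esub> (e \<otimes>\<^bsub>M\<^esub> c) \<otimes>\<^bsub>M\<^esub> (m \<otimes>\<^bsub>M\<^esub> w)"
    using e by (simp add: M.inv_mult_group)
  finally have "inv\<^bsub>M\<^esub> c'' \<otimes>\<^bsub>M\<^esub> m'' = inv\<^bsub>M\<^esub> c \<otimes>\<^bsub>M\<^esub> m \<otimes>\<^bsub>M\<^esub> gM g (inv\<^bsub>M\<^esub> c' \<otimes>\<^bsub>M\<^esub> m') \<longleftrightarrow>
      inv\<^bsub>M\<^esub> c'' \<otimes>\<^bsub>M\<^esub> m'' = inv\<^bsub>M\<^esub> (e \<otimes>\<^bsub>M\<^esub> c) \<otimes>\<^bsub>M\<^esub> (m \<otimes>\<^bsub>M\<^esub> w)"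
    using act by simp
  also have "\<dots> \<longleftrightarrow> m \<otimes>\<^bsub>M\<^esub> w = e \<otimes>\<^bsub>M\<^esub> c \<otimes>\<^bsub>M\<^esub> (inv\<^bsub>M\<^esub> c'' \<otimes>\<^bsub>M\<^esub> m'')"
    using e w m by (metis M.inv_closed M.inv_solve_left M.m_closed cM)
  \<comment> \<open>Centrality of c restores the order of factors used in
    \<open>coboundary1\<close>.\<close>
  also have "e \<otimes>\<^bsub>M\<^esub> c \<otimes>\<^bsub>M\<^esub> (inv\<^bsub>M\<^esub> c'' \<otimes>\<^bsub>M\<^esub> m'') = e \<otimes>\<^bsub>M\<^esub> inv\<^bsub>M\<^esub> c'' \<otimes>\<^bsub>M\<^esub> c \<otimes>\<^bsub>M\<^esub> m''"
    using A_central[OF c(1), of "inv\<^bsub>M\<^esub> c''"] e m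
    by (smt (verit) M.inv_closed M.m_assoc M.m_closed cM)
  also have "m \<otimes>\<^bsub>M\<^esub> w = e \<otimes>\<^bsub>M\<^esub> inv\<^bsub>M\<^esub> c'' \<otimes>\<^bsub>M\<^esub> c \<otimes>\<^bsub>M\<^esub> m'' \<longleftrightarrow>
      m \<otimes>\<^bsub>M\<^esub> w \<otimes>\<^bsub>M\<^esub> inv\<^bsub>M\<^esub> m'' = e \<otimes>\<^bsub>M\<^esub> inv\<^bsub>M\<^esub> c'' \<otimes>\<^bsub>M\<^esub> c"
    using e w m by (metis M.inv_closed M.inv_solve_right' M.m_closed cM)
  finally show ?thesis
    by (simp add: e_def w_def)
qed

text \<open>Writing \<open>s g = (m g, g)\<close>, the relation
  \<open>n g = inv (c g) \<otimes> m g\<close> matches cochains c whose coboundary is the factor set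
  with splittings n.\<close>

lemma factor_set_coboundary_iff_splitting:
  assumes x: "x \<in> carrier L"
    and s: "s \<in> carrier G \<rightarrow> carrier (B x)" "\<forall>g \<in> carrier G. snd (s g) = g"
  shows "factor_set G A (B x) (\<lambda>u. (u, \<one>\<^bsub>G\<^esub>)) s \<in> coboundaries2 G A (ker_action M L d gM) \<longleftrightarrow>
    (\<exists>n. splitting x n)"
    (is "?f \<in> _ \<longleftrightarrow> _")
proof
  define m where "m g = fst (s g)" for g
  have sm: "s g = (m g, g)" if "g \<in> carrier G" for g
    using s(2) that by (simp add: m_def prod_eq_iff)
  have m: "m g \<in> carrier M" "d (m g) \<otimes>\<^bsub>L\<^esub> gL g x = x" if "g \<in> carrier G" for g
    using s(1) sm that by (auto simp: Pi_iff carrier_B)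
  have f_ext: "?f \<in> extensional (carrier G \<times> carrier G)"
    by (simp add: factor_set_def)
  note f = factor_set_B(2)[OF x s(1) sm]
  have cob: "coboundary1 G A (ker_action M L d gM) c (g, h) =
      gM g (c h) \<otimes>\<^bsub>M\<^esub> inv\<^bsub>M\<^esub> c (g \<otimes>\<^bsub>G\<^esub> h) \<otimes>\<^bsub>M\<^esub> c g"
    if "c \<in> carrier G \<rightarrow> carrier A" "g \<in> carrier G" "h \<in> carrier G" for c g h
  proof -
    have "c h \<in> carrier A" "c (g \<otimes>\<^bsub>G\<^esub> h) \<in> carrier A"
      using that by auto
    then show ?thesis
      using that(2,3) by (simp add: coboundary1_def mult_A inv_A ker_action_eq)
  qed
  {
    assume "?f \<in> coboundaries2 G A (ker_action M L d gM)"
    then obtain c where c: "c \<in> carrier G \<rightarrow> carrier A"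
      and fc: "?f = coboundary1 G A (ker_action M L d gM) c"
      unfolding coboundaries2_def by blast
    have cA: "c g \<in> carrier A" if "g \<in> carrier G" for g
      using c that by blast
    define n where "n g = inv\<^bsub>M\<^esub> c g \<otimes>\<^bsub>M\<^esub> m g" for g
    have "splitting x n"
      unfolding splitting_def
    proof (intro conjI ballI)
      show "n \<in> carrier G \<rightarrow> carrier M"
        using cA m by (simp add: n_def carrier_A)
      show "d (n g) \<otimes>\<^bsub>L\<^esub> gL g x = x" if "g \<in> carrier G" for g
        using cA[OF that] m[OF that] x by (simp add: n_def carrier_A)
      show "n (g \<otimes>\<^bsub>G\<^esub> h) = n g \<otimes>\<^bsub>M\<^esub> gM g (n h)" if gh: "g \<in> carrier G" "h \<in> carrier G" for g h
      proof -
        have "m g \<otimes>\<^bsub>M\<^esub> gM g (m h) \<otimes>\<^bsub>M\<^esub> inv\<^bsub>M\<^esub> m (g \<otimes>\<^bsub>G\<^esub> h) =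
            gM g (c h) \<otimes>\<^bsub>M\<^esub> inv\<^bsub>M\<^esub> c (g \<otimes>\<^bsub>G\<^esub> h) \<otimes>\<^bsub>M\<^esub> c g"
          using f[OF _ gh] cob[OF c gh] fc by simp
        then show ?thesis
          using gh by (simp add: crossed_hom_iff_coboundary cA m n_def)
      qed
    qed
    then show "\<exists>n. splitting x n" by blast
  next
    assume "\<exists>n. splitting x n"
    then obtain n where n: "n \<in> carrier G \<rightarrow> carrier M"
      "\<And>g. g \<in> carrier G \<Longrightarrow> d (n g) \<otimes>\<^bsub>L\<^esub> gL g x = x"
      "\<And>g h. \<lbrakk>g \<in> carrier G; h \<in> carrier G\<rbrakk> \<Longrightarrow> n (g \<otimes>\<^bsub>G\<^esub> h) = n g \<otimes>\<^bsub>M\<^esub> gM g (n h)"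
      unfolding splitting_def by blast
    have nM: "n g \<in> carrier M" if "g \<in> carrier G" for g
      using n(1) that by blast
    \<comment> \<open>The discrepancy between the chosen section and the splitting. It lies in A
      because \<open>m g\<close> and \<open>n g\<close> satisfy the same equation with
      \<open>gL g x\<close>, which forces equal boundaries.\<close>
    define c where "c g = m g \<otimes>\<^bsub>M\<^esub> inv\<^bsub>M\<^esub> n g" for g
    have cA: "c g \<in> carrier A" if "g \<in> carrier G" for g
    proof -
      have "d (m g) = d (n g)"
        using m[OF that] n(2)[OF that] nM[OF that] x that
        by (metis L.r_cancel boundary.hom_closed gL.act_closed)
      then show ?thesis
        using m[OF that] nM[OF that] by (simp add: c_def carrier_A)
    qed
    then have c: "c \<in> carrier G \<rightarrow> carrier A" by blast
    have n_c: "n g = inv\<^bsub>M\<^esub> c g \<otimes>\<^bsub>M\<^esub> m g" if "g \<in> carrier G" for g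
      using m[OF that] nM[OF that] by (simp add: c_def M.inv_mult_group M.m_assoc)
    have "?f = coboundary1 G A (ker_action M L d gM) c"
    proof (rule extensionalityI[OF f_ext])
      show "coboundary1 G A (ker_action M L d gM) c \<in> extensional (carrier G \<times> carrier G)"
        by (simp add: coboundary1_def)
      fix u assume "u \<in> carrier G \<times> carrier G"
      then obtain g h where u: "u = (g, h)" and gh: "g \<in> carrier G" "h \<in> carrier G" by blast
      have "m g \<otimes>\<^bsub>M\<^esub> gM g (m h) \<otimes>\<^bsub>M\<^esub> inv\<^bsub>M\<^esub> m (g \<otimes>\<^bsub>G\<^esub> h) =
          gM g (c h) \<otimes>\<^bsub>M\<^esub> inv\<^bsub>M\<^esub> c (g \<otimes>\<^bsub>G\<^esub> h) \<otimes>\<^bsub>M\<^esub> c g"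
        using gh n(3)[OF gh] by (simp add: crossed_hom_iff_coboundary cA m n_c)
      then show "?f u = coboundary1 G A (ker_action M L d gM) c u"
        using f[OF _ gh] cob[OF c gh] u by simp
    qed
    with c show "?f \<in> coboundaries2 G A (ker_action M L d gM)"
      unfolding coboundaries2_def by blast
  }
qed

text \<open>This is surjectivity of the projection from \<open>B x\<close> to G: by invariance
  \<open>gL g x\<close> stays in the coset of x, so the two differ by a boundary.\<close>

lemma coset_fixed:
  assumes "coker_proj M L d x \<in> H0 G (coker_group M L d) (coker_action M L d gL)"
    and x: "x \<in> carrier L" and g: "g \<in> carrier G"
  shows "\<exists>m \<in> carrier M. d m \<otimes>\<^bsub>L\<^esub> gL g x = x"
proof -
  have "coker_proj M L d x \<in> carrier (coker_group M L d)"
    and "coker_action M L d gL g (coker_proj M L d x) = coker_proj M L d x"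
    using assms(1) g by (simp_all add: H0_def)
  then have "gL g ` coker_proj M L d x = coker_proj M L d x"
    by (simp add: coker_action_def)
  moreover have "x \<in> coker_proj M L d x"
    unfolding coker_proj_def by (rule L.rcos_self[OF x boundary.img_is_subgroup])
  ultimately obtain m where m: "m \<in> carrier M" "gL g x = d m \<otimes>\<^bsub>L\<^esub> x"
    unfolding coker_proj_def r_coset_def by blast
  then have "d (inv\<^bsub>M\<^esub> m) \<otimes>\<^bsub>L\<^esub> gL g x = x"
    using x by (simp add: L.m_assoc[symmetric])
  then show ?thesis using m by blast
qed

text \<open>The form with \<open>obtains\<close> exposes the representative x that
  \<open>SOME\<close> selects inside \<open>obstruction\<close>. The passage between splittings and
  bitorsors holds for every representative of a, so it applies to this one.\<close>

lemma obstruction_trivial_iff: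
  assumes a: "a \<in> H0 G (coker_group M L d) (coker_action M L d gL)"
  obtains x where "x \<in> carrier L" "coker_proj M L d x = a"
    "obstruction M L d G gM gL a = \<one>\<^bsub>H2 G A (ker_action M L d gM)\<^esub> \<longleftrightarrow> (\<exists>n. splitting x n)"
proof -
  define x where "x = (SOME x. x \<in> carrier L \<and> coker_proj M L d x = a)"
  have "\<exists>x. x \<in> carrier L \<and> coker_proj M L d x = a"
    using a by (auto simp: H0_def coker_group_def FactGroup_def RCOSETS_def coker_proj_def)
  from someI_ex[OF this] have x: "x \<in> carrier L" and xa: "coker_proj M L d x = a"
    unfolding x_def by simp_all
  have fixed: "\<exists>m \<in> carrier M. d m \<otimes>\<^bsub>L\<^esub> gL g x = x" if "g \<in> carrier G" for g
    using coset_fixed[of x g] a xa x that by simp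
  define s where "s = (SOME s. s \<in> carrier G \<rightarrow> carrier (B x) \<and> (\<forall>g \<in> carrier G. snd (s g) = g))"
  \<comment> \<open>A section exists by \<open>fixed\<close>, so the \<open>SOME\<close> inside
    \<open>extension_class\<close> really yields one.\<close>
  have "\<exists>s. s \<in> carrier G \<rightarrow> carrier (B x) \<and> (\<forall>g \<in> carrier G. snd (s g) = g)"
  proof -
    obtain m where "\<And>g. g \<in> carrier G \<Longrightarrow> m g \<in> carrier M \<and> d (m g) \<otimes>\<^bsub>L\<^esub> gL g x = x"
      using fixed by metis
    then show ?thesis
      by (intro exI[of _ "\<lambda>g. (m g, g)"]) (simp add: carrier_B)
  qed
  from someI_ex[OF this]
  have s: "s \<in> carrier G \<rightarrow> carrier (B x)" "\<forall>g \<in> carrier G. snd (s g) = g"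
    unfolding s_def by (rule conjunct1, rule conjunct2)
  let ?f = "factor_set G A (B x) (\<lambda>u. (u, \<one>\<^bsub>G\<^esub>)) s"
  have "?f (g, h) \<in> carrier A" if "g \<in> carrier G" "h \<in> carrier G" for g h
    using factor_set_B[OF x s(1) _ that, of "\<lambda>g. fst (s g)"] s(2) by (simp add: prod_eq_iff)
  then have "?f \<in> carrier G \<times> carrier G \<rightarrow>\<^sub>E carrier A"
    by (auto simp: PiE_def Pi_def) (simp add: factor_set_def)
  then have "coboundaries2 G A (ker_action M L d gM) #>\<^bsub>cocycles2 G A (ker_action M L d gM)\<^esub> ?f =
      coboundaries2 G A (ker_action M L d gM) \<longleftrightarrow> (\<exists>n. splitting x n)"
    using coset_coboundaries2_eq_iff[OF G.group_axioms A_comm_group ker_action_hom]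
      factor_set_coboundary_iff_splitting[OF x s] by simp
  moreover have "obstruction M L d G gM gL a =
      coboundaries2 G A (ker_action M L d gM) #>\<^bsub>cocycles2 G A (ker_action M L d gM)\<^esub> ?f"
    by (simp add: obstruction_def extension_class_def x_def[symmetric] s_def[symmetric])
  ultimately show thesis
    using that[OF x xa] by (simp add: H2_def FactGroup_def)
qed

section \<open>Bitorsors and splittings\<close>

lemma pi_star_eq:
  assumes "bitorsor M L d G gM gL P ract gP \<alpha>" and p: "p \<in> P"
  shows "pi_star M L d P \<alpha> = coker_proj M L d (inv\<^bsub>L\<^esub> \<alpha> p)"
proof -
  interpret bitorsor M L d G gM gL P ract gP \<alpha> by fact
  \<comment> \<open>Replacing p by \<open>ract p m\<close> multiplies the inverse of
    \<open>\<alpha> p\<close> on the left by a boundary, so the coset is unchanged. The image is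
    thus a singleton, and \<open>the_elem\<close> returns its element.\<close>
  have eq: "coker_proj M L d (inv\<^bsub>L\<^esub> \<alpha> q) = coker_proj M L d (inv\<^bsub>L\<^esub> \<alpha> p)" if q: "q \<in> P" for q
  proof -
    have mem: "\<alpha> p \<in> carrier L" "\<alpha> q \<in> carrier L"
      using alpha_closed p q by auto
    obtain m where m: "m \<in> carrier M" "q = ract p m"
      using simply_transitive[OF p q] by blast
    then have "inv\<^bsub>L\<^esub> \<alpha> q = d (inv\<^bsub>M\<^esub> m) \<otimes>\<^bsub>L\<^esub> inv\<^bsub>L\<^esub> \<alpha> p"
      using p mem by (simp add: alpha_ract L.inv_mult_group)
    then have "\<exists>k \<in> carrier M. inv\<^bsub>L\<^esub> \<alpha> q = d k \<otimes>\<^bsub>L\<^esub> inv\<^bsub>L\<^esub> \<alpha> p"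
      by (rule bexI) (rule M.inv_closed[OF m(1)])
    then show ?thesis
      by (rule coker_proj_eq_iff[THEN iffD2, rotated 2]) (simp_all add: mem)
  qed
  have "(\<lambda>p. coker_proj M L d (bitorsor_xi L \<alpha> p)) ` P =
      (\<lambda>_. coker_proj M L d (inv\<^bsub>L\<^esub> \<alpha> p)) ` P"
    unfolding bitorsor_xi_def by (rule image_cong[OF refl eq])
  also have "\<dots> = {coker_proj M L d (inv\<^bsub>L\<^esub> \<alpha> p)}"
    using p by blast
  finally show ?thesis
    by (simp add: pi_star_def)
qed

lemma splitting_if_bitorsor:
  assumes bit: "bitorsor M L d G gM gL P ract gP \<alpha>"
    and x: "x \<in> carrier L" and pi: "pi_star M L d P \<alpha> = coker_proj M L d x"
  shows "\<exists>n. splitting x n"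
proof -
  interpret bitorsor M L d G gM gL P ract gP \<alpha> by fact
  interpret gP: group_action G P gP by (rule left_action)
  obtain p where p: "p \<in> P" using nonempty by blast
  have ap: "\<alpha> p \<in> carrier L" using alpha_closed p by blast
  have "coker_proj M L d (inv\<^bsub>L\<^esub> \<alpha> p) = coker_proj M L d x"
    using pi pi_star_eq[OF bit p] by simp
  then obtain m where m: "m \<in> carrier M" "inv\<^bsub>L\<^esub> \<alpha> p = d m \<otimes>\<^bsub>L\<^esub> x"
    using x ap coker_proj_eq_iff by auto
  \<comment> \<open>The point p is moved by m to absorb the boundary by which the inverse of
    \<open>\<alpha> p\<close> differs from x; this makes \<open>\<alpha> q\<close> the inverse of
    x.\<close>
  define q where "q = ract p m"
  have q: "q \<in> P" using p m by (simp add: q_def ract_closed)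
  have "\<alpha> p = inv\<^bsub>L\<^esub> (d m \<otimes>\<^bsub>L\<^esub> x)"
    using m(2) ap by (metis L.inv_inv)
  then have aq: "\<alpha> q = inv\<^bsub>L\<^esub> x"
    using p m x by (simp add: q_def alpha_ract L.inv_mult_group L.m_assoc)
  have gq: "gP g q \<in> P" if "g \<in> carrier G" for g
    using gP.element_image[OF that q] by simp
  then have "\<exists>n. n \<in> carrier M \<and> gP g q = ract q n" if "g \<in> carrier G" for g
    using simply_transitive[OF q] that by blast
  then obtain n where n: "\<And>g. g \<in> carrier G \<Longrightarrow> n g \<in> carrier M \<and> gP g q = ract q (n g)"
    by metis
  have "splitting x n"
    unfolding splitting_def
  proof (intro conjI ballI)
    show "n \<in> carrier G \<rightarrow> carrier M" using n by blast
    show "d (n g) \<otimes>\<^bsub>L\<^esub> gL g x = x" if g: "g \<in> carrier G" for g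
    proof -
      \<comment> \<open>Both sides compute \<open>\<alpha> (gP g q)\<close>: the left through
        \<open>gP g q = ract q (n g)\<close>, the right through equivariance.\<close>
      have "inv\<^bsub>L\<^esub> x \<otimes>\<^bsub>L\<^esub> d (n g) = inv\<^bsub>L\<^esub> gL g x"
        using alpha_equivariant[OF g q] alpha_ract[OF q, of "n g"] n[OF g] g x
        by (simp add: aq gL.act_inv)
      then have "d (n g) = x \<otimes>\<^bsub>L\<^esub> inv\<^bsub>L\<^esub> gL g x"
        using n[OF g] g x
        by (metis L.inv_closed L.inv_inv L.inv_solve_left boundary.hom_closed gL.act_closed)
      then show ?thesis
        using g x by (simp add: L.m_assoc)
    qed
    show "n (g \<otimes>\<^bsub>G\<^esub> h) = n g \<otimes>\<^bsub>M\<^esub> gM g (n h)" if gh: "g \<in> carrier G" "h \<in> carrier G" for g h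
    proof -
      \<comment> \<open>The point \<open>gP (g \<otimes> h) q\<close> is written in two ways as a
        translate of q; uniqueness of the translating element gives the crossed homomorphism
        law.\<close>
      have "gP (g \<otimes>\<^bsub>G\<^esub> h) q = gP g (gP h q)"
        using gP.composition_rule[OF q gh] by simp
      also have "\<dots> = ract q (n g \<otimes>\<^bsub>M\<^esub> gM g (n h))"
        using n gh q by (simp add: compatible ract_mult)
      finally have "ract q (n (g \<otimes>\<^bsub>G\<^esub> h)) = ract q (n g \<otimes>\<^bsub>M\<^esub> gM g (n h))"
        using n gh by simp
      moreover have "n (g \<otimes>\<^bsub>G\<^esub> h) \<in> carrier M" "n g \<otimes>\<^bsub>M\<^esub> gM g (n h) \<in> carrier M"
        using n gh by simp_all
      ultimately show ?thesis
        using simply_transitive[OF q ract_closed[OF q]] by metis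
    qed
  qed
  then show ?thesis by blast
qed

text \<open>The crossed homomorphism law makes the twisted \<open>gP\<close> an action, and the
  boundary condition on n makes \<alpha> equivariant. The restriction in \<open>gP\<close> is there
  because elements of \<open>BijGroup\<close> are extensional.\<close>

lemma bitorsor_if_splitting:
  assumes "splitting x n" and x: "x \<in> carrier L"
  defines "gP \<equiv> \<lambda>g. \<lambda>p \<in> carrier M. n g \<otimes>\<^bsub>M\<^esub> gM g p"
    and "\<alpha> \<equiv> \<lambda>p. inv\<^bsub>L\<^esub> x \<otimes>\<^bsub>L\<^esub> d p"
  shows "bitorsor M L d G gM gL (carrier M) (\<otimes>\<^bsub>M\<^esub>) gP \<alpha>"
    and "pi_star M L d (carrier M) \<alpha> = coker_proj M L d x"
proof -
  have n: "n g \<in> carrier M" "d (n g) \<otimes>\<^bsub>L\<^esub> gL g x = x" if "g \<in> carrier G" for g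
    using assms(1) that unfolding splitting_def by auto
  have n_mult: "n (g \<otimes>\<^bsub>G\<^esub> h) = n g \<otimes>\<^bsub>M\<^esub> gM g (n h)" if "g \<in> carrier G" "h \<in> carrier G" for g h
    using assms(1) that unfolding splitting_def by blast
  have gP_closed: "gP g p \<in> carrier M" if "g \<in> carrier G" "p \<in> carrier M" for g p
    using that n by (simp add: gP_def)
  have gP_comp: "gP (g \<otimes>\<^bsub>G\<^esub> h) p = gP g (gP h p)"
    if "g \<in> carrier G" "h \<in> carrier G" "p \<in> carrier M" for g h p
    using that n by (simp add: gP_def n_mult gM.act_comp gM.act_mult M.m_assoc)
  \<comment> \<open>At the identity the crossed homomorphism law makes this value idempotent, hence
    trivial; so the identity of G acts trivially under \<open>gP\<close>.\<close>
  have n_one: "n \<one>\<^bsub>G\<^esub> = \<one>\<^bsub>M\<^esub>"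
  proof -
    have "n \<one>\<^bsub>G\<^esub> = n \<one>\<^bsub>G\<^esub> \<otimes>\<^bsub>M\<^esub> n \<one>\<^bsub>G\<^esub>"
      using n_mult[of "\<one>\<^bsub>G\<^esub>" "\<one>\<^bsub>G\<^esub>"] n by (simp add: gM.one_act)
    then show ?thesis
      using n(1)[of "\<one>\<^bsub>G\<^esub>"] by (metis G.one_closed M.l_cancel_one')
  qed
  have gP_one: "gP \<one>\<^bsub>G\<^esub> p = p" if "p \<in> carrier M" for p
    using that by (simp add: gP_def n_one gM.one_act)
  have gP_bij: "gP g \<in> Bij (carrier M)" if g: "g \<in> carrier G" for g
  proof -
    have "bij_betw (gP g) (carrier M) (carrier M)"
    proof (rule bij_betw_byWitness[where f' = "gP (inv\<^bsub>G\<^esub> g)"])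
      show "\<forall>p \<in> carrier M. gP (inv\<^bsub>G\<^esub> g) (gP g p) = p"
        using g by (simp add: gP_comp[symmetric] gP_one)
      show "\<forall>p \<in> carrier M. gP g (gP (inv\<^bsub>G\<^esub> g) p) = p"
        using g by (simp add: gP_comp[symmetric] gP_one)
    qed (use g gP_closed in auto)
    then show ?thesis by (simp add: Bij_def gP_def)
  qed
  have hom: "gP \<in> hom G (BijGroup (carrier M))"
  proof (rule homI)
    fix g h assume gh: "g \<in> carrier G" "h \<in> carrier G"
    then show "gP g \<in> carrier (BijGroup (carrier M))"
      by (simp add: BijGroup_def gP_bij)
    have "gP (g \<otimes>\<^bsub>G\<^esub> h) = compose (carrier M) (gP g) (gP h)"
    proof (rule extensionalityI[of _ "carrier M"])
      show "gP (g \<otimes>\<^bsub>G\<^esub> h) \<in> extensional (carrier M)"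
        by (simp add: gP_def)
    qed (use gh in \<open>simp_all add: compose_eq gP_comp\<close>)
    then show "gP (g \<otimes>\<^bsub>G\<^esub> h) = gP g \<otimes>\<^bsub>BijGroup (carrier M)\<^esub> gP h"
      using gh by (simp add: BijGroup_def gP_bij)
  qed
  have action: "group_action G (carrier M) gP"
    by (intro group_action.intro group_hom.intro group_hom_axioms.intro G.group_axioms group_BijGroup hom)
  show bit: "bitorsor M L d G gM gL (carrier M) (\<otimes>\<^bsub>M\<^esub>) gP \<alpha>"
  proof (intro bitorsor.intro right_torsor.intro bitorsor_axioms.intro)
    show "carrier M \<noteq> {}" using M.one_closed by blast
    show "\<alpha> \<in> carrier M \<rightarrow> carrier L" using x by (simp add: \<alpha>_def)
    show "group_action G (carrier M) gP" by (rule action)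
  next
    fix g p m assume "g \<in> carrier G" "p \<in> carrier M" "m \<in> carrier M"
    then show "gP g (p \<otimes>\<^bsub>M\<^esub> m) = gP g p \<otimes>\<^bsub>M\<^esub> gM g m"
      using n by (simp add: gP_def gM.act_mult M.m_assoc)
  next
    fix p q assume pq: "p \<in> carrier M" "q \<in> carrier M"
    show "\<exists>!m. m \<in> carrier M \<and> q = p \<otimes>\<^bsub>M\<^esub> m"
    proof (rule ex1I[of _ "inv\<^bsub>M\<^esub> p \<otimes>\<^bsub>M\<^esub> q"])
      show "inv\<^bsub>M\<^esub> p \<otimes>\<^bsub>M\<^esub> q \<in> carrier M \<and> q = p \<otimes>\<^bsub>M\<^esub> (inv\<^bsub>M\<^esub> p \<otimes>\<^bsub>M\<^esub> q)"
        using pq by (simp add: M.m_assoc[symmetric])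
    qed (use pq in \<open>auto simp: M.m_assoc[symmetric]\<close>)
  next
    fix g p assume g: "g \<in> carrier G" and p: "p \<in> carrier M"
    \<comment> \<open>The boundary condition becomes equivariance of \<alpha> at the base point 1,
      where \<open>gP g\<close> takes the value \<open>n g\<close>. The case of general p follows by
      multiplying by the image of p.\<close>
    have "d (n g) = x \<otimes>\<^bsub>L\<^esub> inv\<^bsub>L\<^esub> gL g x"
      using n[OF g] g x by (metis L.inv_solve_right boundary.hom_closed gL.act_closed)
    then have "inv\<^bsub>L\<^esub> x \<otimes>\<^bsub>L\<^esub> d (n g) = inv\<^bsub>L\<^esub> gL g x"
      using g x by (simp add: L.m_assoc[symmetric])
    then show "\<alpha> (gP g p) = gL g (\<alpha> p)"
      using n[OF g] g x p
      by (simp add: \<alpha>_def gP_def gL.act_mult gL.act_inv boundary_equivariant L.m_assoc[symmetric])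
  next
    fix p m assume "p \<in> carrier M" "m \<in> carrier M"
    then show "\<alpha> (p \<otimes>\<^bsub>M\<^esub> m) = \<alpha> p \<otimes>\<^bsub>L\<^esub> d m"
      using x by (simp add: \<alpha>_def L.m_assoc)
  qed (auto simp: M.m_assoc)
  \<comment> \<open>Evaluated at the base point 1, where \<alpha> is the inverse of x.\<close>
  show "pi_star M L d (carrier M) \<alpha> = coker_proj M L d x"
    using pi_star_eq[OF bit M.one_closed] x by (simp add: \<alpha>_def)
qed

end

text \<open>A formula quantifies over bitorsors whose points have one fixed type. The twisted torsor
  lives on M itself, so the equivalence is stated for points of type \<open>'m\<close>. The second
  conjunct gives the converse direction for points of an arbitrary type \<open>'p\<close>.\<close>

theorem lemma30:
  fixes M :: "('m, 'r) monoid_scheme" and L :: "('l, 's) monoid_scheme"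
    and d :: "'m \<Rightarrow> 'l" and lact :: "'l \<Rightarrow> 'm \<Rightarrow> 'm"
    and G :: "('g, 't) monoid_scheme"
    and gM :: "'g \<Rightarrow> 'm \<Rightarrow> 'm" and gL :: "'g \<Rightarrow> 'l \<Rightarrow> 'l"
    and a :: "'l set"
  assumes "equivariant_crossed_module M L d lact G gM gL"
    and "a \<in> H0 G (coker_group M L d) (coker_action M L d gL)"
  shows "(obstruction M L d G gM gL a = \<one>\<^bsub>H2 G (ker_group M L d) (ker_action M L d gM)\<^esub> \<longleftrightarrow>
            (\<exists>(P :: 'm set) ract gP \<alpha>.
               bitorsor M L d G gM gL P ract gP \<alpha> \<and> pi_star M L d P \<alpha> = a)) \<and>
         ((\<exists>(P :: 'p set) ract gP \<alpha>.
               bitorsor M L d G gM gL P ract gP \<alpha> \<and> pi_star M L d P \<alpha> = a) \<longrightarrow>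
            obstruction M L d G gM gL a = \<one>\<^bsub>H2 G (ker_group M L d) (ker_action M L d gM)\<^esub>)"
proof -
  interpret equivariant_crossed_module M L d lact G gM gL by fact
  obtain x where x: "x \<in> carrier L" "coker_proj M L d x = a"
    and iff: "obstruction M L d G gM gL a = \<one>\<^bsub>H2 G (ker_group M L d) (ker_action M L d gM)\<^esub> \<longleftrightarrow>
      (\<exists>n. splitting x n)"
    using obstruction_trivial_iff[OF assms(2)] by blast
  have "\<exists>(P :: 'm set) ract gP \<alpha>. bitorsor M L d G gM gL P ract gP \<alpha> \<and> pi_star M L d P \<alpha> = a"
    if "splitting x n" for n
    using bitorsor_if_splitting[OF that x(1)] x(2) by blast
  then show ?thesis
    unfolding iff using splitting_if_bitorsor[OF _ x(1)] x(2) by metis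
qed

end
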